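(* Let $\Gamma_n$ be an $n$-sided planar convex polygon circumscribed about a circle of radius $R>0$, with perimeter $L_n$ and area $A_n$. Let $L_n^\ast$ be the perimeter of the regular $n$-sided convex polygon circumscribed about the same circle, and let $d_n=n\tan\frac{\pi}{n}$. Then for every positive integer $\alpha$, $$L_n^{2\alpha}-4^\alpha\left(d_nA_n\right)^\alpha\geq 2^\alpha R^\alpha\left(\tan\frac{\pi}{n}\right)^\alpha\left[L_n^\alpha-\left(L_n^\ast\right)^\alpha\right]$$ and $$\left(\frac{A_n}{R^2}\right)^{2\alpha}-d_n^\alpha\left(\frac{L_n}{2R}\right)^\alpha\geq\left(\tan\frac{\pi}{n}\right)^\alpha\left[\left(\frac{L_n}{2R}\right)^\alpha-\left(\frac{L_n^\ast}{2R}\right)^\alpha\right].$$ In each of the two inequalities, equality holds if and only if $\Gamma_n$ is a regular polygon.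
   Context: A convex polygon is circumscribed about a circle if every side of the polygon is tangent to the circle (the circle is the inscribed circle of the polygon). *)

theory Defs
  imports "HOL-Analysis.Analysis"
begin

(* A polygon is the closed planar region. Facets of a two-dimensional polytope are its
   maximal boundary segments, so a straight angle never counts as a vertex;
   "3 <= n" is automatic. *)
definition convex_polygon :: "nat \<Rightarrow> (real^2) set \<Rightarrow> bool" where
  "convex_polygon n P \<longleftrightarrow>
     polytope P \<and> interior P \<noteq> {} \<and> card {F. F facet_of P} = n"

(* Facets are segments here, and the diameter of a segment is its length. *)
definition perimeter :: "(real^2) set \<Rightarrow> real" where
  "perimeter P = (\<Sum>F | F facet_of P. diameter F)"

definition area :: "(real^2) set \<Rightarrow> real" where
  "area P = measure lebesgue P"

(* The point of contact must lie on the segment itself, not just on the line carrying it. *)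
definition segment_tangent_to_circle :: "(real^2) set \<Rightarrow> real^2 \<Rightarrow> real \<Rightarrow> bool" where
  "segment_tangent_to_circle F c R \<longleftrightarrow> (\<exists>p\<in>F. affine hull F \<inter> sphere c R = {p})"

definition circumscribed_about :: "(real^2) set \<Rightarrow> real^2 \<Rightarrow> real \<Rightarrow> bool" where
  "circumscribed_about P c R \<longleftrightarrow> (\<forall>F. F facet_of P \<longrightarrow> segment_tangent_to_circle F c R)"

(* The angle a v b at the vertex v, in [0, pi]. *)
definition angle_at :: "real^2 \<Rightarrow> real^2 \<Rightarrow> real^2 \<Rightarrow> real" where
  "angle_at v a b = arccos (((a - v) \<bullet> (b - v)) / (norm (a - v) * norm (b - v)))"

definition equilateral_polygon :: "(real^2) set \<Rightarrow> bool" where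
  "equilateral_polygon P \<longleftrightarrow> (\<exists>l. \<forall>F. F facet_of P \<longrightarrow> diameter F = l)"

(* Two distinct sides with a common endpoint v are the two sides meeting at the vertex v. *)
definition equiangular_polygon :: "(real^2) set \<Rightarrow> bool" where
  "equiangular_polygon P \<longleftrightarrow>
     (\<exists>\<theta>. \<forall>v a b. closed_segment v a facet_of P \<and> closed_segment v b facet_of P \<and> a \<noteq> b
              \<longrightarrow> angle_at v a b = \<theta>)"

definition regular_polygon :: "(real^2) set \<Rightarrow> bool" where
  "regular_polygon P \<longleftrightarrow> equilateral_polygon P \<and> equiangular_polygon P"

end

theory Submission
  imports Defs
begin

text \<open>
  Joining the centre to the vertices gives A = R L / 2. The point of contact cuts each side into two
  parts, and the part of length t is seen from the centre under the angle arctan (t / R). These 2n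
  angles add up to 2 pi, so the tangent-line bound for the concave function arctan at tan (pi / n)
  yields L \<ge> 2 R n tan (pi / n), with equality iff all 2n parts are equal. The two parts meeting at
  a vertex are equal and determine the angle there, so equality holds exactly for regular polygons.
  With X = L^\<alpha>, Y = Lstar^\<alpha> and K = (2 R tan (pi / n))^\<alpha>, the difference of the two
  sides of the first inequality is (X - Y) (X - K), and X \<ge> Y > K; the second inequality is the first one
  divided by (2 R)^(2 \<alpha>).
\<close>

subsection \<open>Sides as tangent segments\<close>

text \<open>Being circumscribed only says that every side touches the circle; it does not put c
  inside P. Yet the triangles over the sides tile P, and the angles add up to 2 pi, only because c
  is an interior point, so this has to be derived. The second obstacle is that the sides form a set
  without cyclic order: there is no "next" side, so both totals are obtained as measures of pieces
  with negligible overlap, and the neighbour at a vertex comes from the face structure of the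
  polyhedron. The number tan (pi / n) is forced: 2n equal angles with sum 2 pi are pi / n each. The
  tangent-line bound holds for nonnegative arguments only; it applies because the point of contact
  lies on the side itself, so that both parts have nonnegative length. Finally Y > K because Lstar
  is n times 2 R tan (pi / n) and n \<ge> 3, which holds since a side is seen under an angle less
  than pi.\<close>

lemma tangent_hyperplane_eq:
  fixes a c p :: "'a::real_inner"
  assumes a: "a \<noteq> 0" and R: "R > 0" and tangent: "{x. a \<bullet> x = b} \<inter> sphere c R = {p}"
  shows "{x. a \<bullet> x = b} = {x. (p - c) \<bullet> (x - c) = R\<^sup>2}"
proof -
  have p: "a \<bullet> p = b" "norm (p - c) = R"
    using tangent by (auto simp: dist_norm norm_minus_commute)
  define k where "k = (b - a \<bullet> c) / (a \<bullet> a)"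
  have k: "k * (a \<bullet> a) = b - a \<bullet> c"
    using a by (simp add: k_def)
  \<comment> \<open>\<open>c + k *\<^sub>R a\<close> is the foot of the perpendicular from c, and r
    is the mirror image of p in it. Then r also lies on the hyperplane and on the sphere, so
    tangency forces r = p, and p is the foot itself.\<close>
  define r where "r = 2 *\<^sub>R (c + k *\<^sub>R a) - p"
  have "a \<bullet> r = b"
    using k p(1) by (simp add: r_def inner_diff_right inner_add_right algebra_simps)
  moreover have "norm (r - c) = R"
  proof -
    have r: "r - c = (2 * k) *\<^sub>R a - (p - c)"
      by (simp add: r_def algebra_simps scaleR_2)
    have "(norm (m *\<^sub>R a - u))\<^sup>2 = m * (m * (a \<bullet> a)) - 2 * m * (a \<bullet> u) + (norm u)\<^sup>2" for m u
      unfolding power2_norm_eq_inner inner_diff_left inner_diff_right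
      by (simp add: inner_commute [of u a])
    from this [of "2 * k" "p - c"] have "(norm (r - c))\<^sup>2
        = 4 * k * (k * (a \<bullet> a)) - 4 * k * (a \<bullet> (p - c)) + (norm (p - c))\<^sup>2"
      unfolding r by (simp only: mult.assoc)
    also have "\<dots> = R\<^sup>2"
      using k p by (simp add: inner_diff_right)
    finally show ?thesis
      using R by (simp add: power2_eq_iff_nonneg)
  qed
  ultimately have "r \<in> {x. a \<bullet> x = b} \<inter> sphere c R"
    by (simp add: dist_norm norm_minus_commute)
  then have "r = p"
    unfolding tangent by simp
  have "2 *\<^sub>R (c + k *\<^sub>R a) = p + r"
    by (simp add: r_def)
  also have "\<dots> = 2 *\<^sub>R p"
    unfolding \<open>r = p\<close> by (simp add: scaleR_2)
  finally have "c + k *\<^sub>R a = p"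
    by simp
  then have pk: "p - c = k *\<^sub>R a"
    by auto
  then have "k \<noteq> 0"
    using p R by auto
  moreover have "R\<^sup>2 = k * (b - a \<bullet> c)"
  proof -
    have "R\<^sup>2 = (k *\<^sub>R a) \<bullet> (p - c)"
      using p(2) by (simp add: dot_square_norm flip: pk)
    then show ?thesis
      by (simp add: inner_diff_right p(1) right_diff_distrib)
  qed
  ultimately show ?thesis
    by (auto simp: pk inner_diff_right simp flip: right_diff_distrib)
qed

locale circumscribed_polygon =
  fixes P :: "(real^2) set" and c :: "real^2" and R :: real and n :: nat
  assumes R_pos: "R > 0"
    and polygon: "convex_polygon n P"
    and circumscribed: "circumscribed_about P c R"
begin

definition contact :: "(real^2) set \<Rightarrow> real^2" where
  "contact F = (SOME p. p \<in> F \<and> affine hull F \<inter> sphere c R = {p})"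

lemma polytope: "polytope P" and interior_nonempty: "interior P \<noteq> {}"
  and card_facets: "card {F. F facet_of P} = n"
  using polygon by (auto simp: convex_polygon_def)

lemma finite_facets: "finite {F. F facet_of P}"
  by (simp add: finite_polytope_facets polytope)

lemma convex: "convex P" and compact: "compact P" and polyhedron: "polyhedron P" and closed: "closed P"
  using polytope by (auto simp: polytope_imp_convex polytope_imp_compact polytope_imp_polyhedron
      polytope_imp_closed)

lemma frontier_eq: "frontier P = \<Union> {F. F facet_of P}"
  using rel_frontier_of_polyhedron [OF polyhedron] rel_frontier_nonempty_interior [OF interior_nonempty]
  by simp

lemma contact:
  assumes "F facet_of P"
  shows contact_in: "contact F \<in> F"
    and tangent: "affine hull F \<inter> sphere c R = {contact F}"
proof -
  have "\<exists>p. p \<in> F \<and> affine hull F \<inter> sphere c R = {p}"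
    using circumscribed assms by (auto simp: circumscribed_about_def segment_tangent_to_circle_def)
  then have "contact F \<in> F \<and> affine hull F \<inter> sphere c R = {contact F}"
    unfolding contact_def by (rule someI_ex)
  then show "contact F \<in> F" "affine hull F \<inter> sphere c R = {contact F}" by auto
qed

lemma norm_contact: "F facet_of P \<Longrightarrow> norm (contact F - c) = R"
  using tangent by (fastforce simp: dist_norm norm_minus_commute)

lemma inner_contact: "F facet_of P \<Longrightarrow> (contact F - c) \<bullet> (contact F - c) = R\<^sup>2"
  by (simp add: dot_square_norm norm_contact)

lemma aff_dim_facet: "F facet_of P \<Longrightarrow> aff_dim F = 1"
  using aff_dim_nonempty_interior [OF interior_nonempty] by (simp add: facet_of_def)

lemma affine_hull_facet:
  assumes F: "F facet_of P"
  shows "affine hull F = {x. (contact F - c) \<bullet> (x - c) = R\<^sup>2}"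
proof -
  have "aff_dim F = DIM(real^2) - 1"
    using aff_dim_facet [OF F] by simp
  then obtain a b where "a \<noteq> 0" "affine hull F = {x. a \<bullet> x = b}"
    unfolding aff_dim_eq_hyperplane by blast
  then show ?thesis
    using tangent_hyperplane_eq [OF _ R_pos] tangent [OF F] by metis
qed

lemma facet_eq:
  assumes F: "F facet_of P"
  shows "F = P \<inter> {x. (contact F - c) \<bullet> (x - c) = R\<^sup>2}"
  using face_of_imp_eq_affine_Int [OF convex facet_of_imp_face_of [OF F]] affine_hull_facet [OF F]
  by blast

lemma inner_facet: "F facet_of P \<Longrightarrow> x \<in> F \<Longrightarrow> (contact F - c) \<bullet> (x - c) = R\<^sup>2"
  using affine_hull_facet [of F] hull_inc [of x F affine] by blast

text \<open>The point of contact determines the tangent line, and a face is cut out of P by its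
  affine hull.\<close>

lemma contact_inj:
  assumes "F facet_of P" "G facet_of P" "contact F = contact G"
  shows "F = G"
proof -
  have "F = P \<inter> {x. (contact G - c) \<bullet> (x - c) = R\<^sup>2}"
    using facet_eq [OF assms(1)] unfolding assms(3) .
  also have "\<dots> = G"
    by (rule facet_eq [OF assms(2), symmetric])
  finally show ?thesis .
qed

lemma dist_facet_ge:
  assumes F: "F facet_of P" and x: "x \<in> F"
  shows "dist c x \<ge> R"
proof -
  have "R\<^sup>2 = (contact F - c) \<bullet> (x - c)"
    by (rule inner_facet [OF F x, symmetric])
  also have "\<dots> \<le> R * norm (x - c)"
    using norm_cauchy_schwarz [of "contact F - c" "x - c"] by (simp add: norm_contact F)
  finally show ?thesis
    using R_pos by (simp add: power2_eq_square dist_norm norm_minus_commute)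
qed

text \<open>
  Were c outside, every point of contact would be a point of P nearest to c. The nearest point is
  unique, so all sides would lie on one line.
\<close>

lemma center_in_interior: "c \<in> interior P"
proof (rule ccontr)
  assume "c \<notin> interior P"
  have far: "dist c x \<ge> R" if "x \<in> frontier P" for x
    using that dist_facet_ge frontier_eq by blast
  have "c \<notin> frontier P"
    using far [of c] R_pos by auto
  with \<open>c \<notin> interior P\<close> have "c \<notin> P"
    using closure_subset [of P] by (auto simp: frontier_def)
  have "P \<noteq> {}"
    using interior_nonempty by auto
  \<comment> \<open>The bound known on the frontier extends to P because the point of P nearest to c
    lies on the frontier.\<close>
  have far_P: "dist c x \<ge> R" if "x \<in> P" for x
  proof -
    have "closest_point P c \<in> frontier P"
      using closest_point_in_rel_frontier [OF closed \<open>P \<noteq> {}\<close>, of c] \<open>c \<notin> interior P\<close>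
        rel_frontier_nonempty_interior [OF interior_nonempty]
        rel_interior_nonempty_interior [OF interior_nonempty]
        affine_hull_nonempty_interior [OF interior_nonempty] by auto
    then show ?thesis
      using far closest_point_le [OF closed that, of c] by force
  qed
  have "contact F = closest_point P c" if "F facet_of P" for F
    by (rule closest_point_unique [OF convex closed])
      (use that contact_in facet_of_imp_subset norm_contact far_P in
        \<open>auto simp: dist_norm norm_minus_commute\<close>)
  then have one: "F = G" if "F facet_of P" "G facet_of P" for F G
    using that contact_inj by metis
  \<comment> \<open>A compact convex set is the hull of its frontier. This yields some side F and,
    once F is the whole frontier, \<open>P \<subseteq> F\<close>, which is impossible for a
    facet.\<close>
  have "P = convex hull (frontier P)"
    by (rule Krein_Milman_frontier [OF convex compact])
  then obtain F where F: "F facet_of P"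
    using \<open>P \<noteq> {}\<close> unfolding frontier_eq by fastforce
  then have "{F. F facet_of P} = {F}"
    using one by blast
  then have "frontier P = F"
    using frontier_eq by auto
  then have "P \<subseteq> F"
    using \<open>P = convex hull (frontier P)\<close> face_of_imp_convex facet_of_imp_face_of [OF F] convex
    by (metis convex_hull_eq order_refl)
  with F show False
    using facet_of_imp_subset by fastforce
qed

text \<open>The segment from c to a point of P beyond the tangent line would cross that line at an
  interior point of P; but the line meets P only in the proper face F, which contains no interior
  point.\<close>

lemma inner_le:
  assumes F: "F facet_of P" and x: "x \<in> P"
  shows "(contact F - c) \<bullet> (x - c) \<le> R\<^sup>2"
proof (rule ccontr)
  assume "\<not> ?thesis"
  then have gt: "(contact F - c) \<bullet> (x - c) > R\<^sup>2" by simp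
  define s where "s = R\<^sup>2 / ((contact F - c) \<bullet> (x - c))"
  define y where "y = c + s *\<^sub>R (x - c)"
  have pos: "(contact F - c) \<bullet> (x - c) > 0"
    using gt zero_le_power2 [of R] by linarith
  have s: "0 < s" "s < 1"
    using gt pos R_pos by (auto simp: s_def)
  have "x \<noteq> c"
    using pos by auto
  then have "y \<in> open_segment c x"
    using s by (auto simp: in_segment y_def algebra_simps intro!: exI [of _ s])
  then have "y \<in> interior P"
    using in_interior_closure_convex_segment [OF convex center_in_interior] x closure_subset by blast
  moreover have "(contact F - c) \<bullet> (y - c) = R\<^sup>2"
    using pos by (simp add: y_def s_def)
  then have "y \<in> F"
    using facet_eq [OF F] \<open>y \<in> interior P\<close> interior_subset by blast
  ultimately show False
    using face_of_disjoint_interior [OF facet_of_imp_face_of [OF F]] F by fastforce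
qed

lemma ray_meets_facet:
  assumes "v \<noteq> 0"
  obtains F s where "F facet_of P" "s > 0" "c + s *\<^sub>R v \<in> F"
proof -
  have "bounded P"
    using compact compact_imp_bounded by blast
  then obtain d where "0 < d" "c + d *\<^sub>R v \<in> frontier P"
    using ray_to_frontier [OF _ center_in_interior assms] by blast
  then show thesis
    using that frontier_eq by blast
qed

text \<open>A ray from c leaves P only once. The linear functional of either side is R^2 on that
  side and at most R^2 on P, which gives s \<le> t and t \<le> s. The two factors let it serve both
  for directions seen from c and for points shared by two triangles.\<close>

lemma scaled_facet_points_eq:
  assumes F: "F facet_of P" and G: "G facet_of P"
    and "c + v \<in> F" "c + w \<in> G" "s *\<^sub>R v = t *\<^sub>R w" "s > 0" "t > 0"
  shows "v = w"
proof -
  have le: "s' \<le> t'" if "F' facet_of P" "c + v' \<in> F'" "c + w' \<in> P" "s' *\<^sub>R v' = t' *\<^sub>R w'" "t' > 0"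
    for F' s' t' v' w'
  proof -
    have "s' * R\<^sup>2 = (contact F' - c) \<bullet> (s' *\<^sub>R v')"
      using inner_facet [OF that(1,2)] by simp
    also have "\<dots> = t' * ((contact F' - c) \<bullet> w')"
      using that(4) by simp
    also have "\<dots> \<le> t' * R\<^sup>2"
      using inner_le [OF that(1,3)] that(5) by simp
    finally show ?thesis
      using R_pos by simp
  qed
  have "s \<le> t" "t \<le> s"
    using le [OF F, of v w s t] le [OF G, of w v t s] assms facet_of_imp_subset by fastforce+
  then show ?thesis
    using assms by simp
qed

text \<open>Two common points would span the affine hull of both sides, since each has dimension 1,
  and a face is determined by its affine hull.\<close>

lemma facet_Int_unique:
  assumes F: "F facet_of P" and G: "G facet_of P" and "F \<noteq> G"
    and "x \<in> F \<inter> G" "y \<in> F \<inter> G"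
  shows "x = y"
proof (rule ccontr)
  assume "x \<noteq> y"
  then have "aff_dim {x, y} = 1"
    by (simp add: aff_dim_2)
  have "affine hull {x, y} = affine hull H" if "H facet_of P" "x \<in> H" "y \<in> H" for H
    by (rule affine_dim_equal)
      (use that \<open>aff_dim {x, y} = 1\<close> in \<open>auto simp: aff_dim_facet intro!: hull_mono\<close>)
  then have "affine hull F = affine hull G"
    using assms by blast
  then show False
    using face_of_imp_eq_affine_Int [OF convex] F G \<open>F \<noteq> G\<close> facet_of_imp_face_of by metis
qed

end

section \<open>Unit vectors and orthonormal frames in the plane\<close>

definition dir :: "real \<Rightarrow> real^2" where
  "dir \<theta> = vector [cos \<theta>, sin \<theta>]"

lemma dir_nth [simp]: "dir \<theta> $ 1 = cos \<theta>" "dir \<theta> $ 2 = sin \<theta>"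
  by (simp_all add: dir_def)

lemma inner_real2: "x \<bullet> y = x $ 1 * y $ 1 + x $ 2 * y $ 2" for x y :: "real^2"
  by (simp add: inner_vec_def sum_2)

lemma inner_dir: "dir \<theta> \<bullet> dir \<phi> = cos (\<theta> - \<phi>)"
  by (simp add: inner_real2 cos_diff)

lemma norm_dir [simp]: "norm (dir \<theta>) = 1"
  by (simp add: norm_eq_sqrt_inner inner_dir)

lemma dir_nonzero [simp]: "dir \<theta> \<noteq> 0"
  using norm_dir [of \<theta>] by force

lemma cos_sin_add_pi_half: "cos (\<theta> + pi / 2) = - sin \<theta>" "sin (\<theta> + pi / 2) = cos \<theta>" for \<theta> :: real
  by (simp_all add: cos_add sin_add)

lemma dir_eq_combination:
  "dir \<psi> = cos (\<psi> - \<theta>) *\<^sub>R dir \<theta> + sin (\<psi> - \<theta>) *\<^sub>R dir (\<theta> + pi / 2)"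
proof -
  have "dir \<psi> = dir (\<theta> + (\<psi> - \<theta>))" by simp
  then show ?thesis
    unfolding vec_eq_iff forall_2 vector_add_component vector_scaleR_component dir_nth cos_sin_add_pi_half
    by (metis cos_add sin_add real_scaleR_def mult.commute mult_minus_right diff_conv_add_uminus add.commute)
qed

lemma orthogonal_decomposition:
  "v = (dir \<theta> \<bullet> v) *\<^sub>R dir \<theta> + (dir (\<theta> + pi / 2) \<bullet> v) *\<^sub>R dir (\<theta> + pi / 2)"
proof -
  have "cos \<theta> * cos \<theta> + sin \<theta> * sin \<theta> = 1"
    by (rule sin_cos_squared_add3)
  then have "v $ 1 = (cos \<theta> * v $ 1 + sin \<theta> * v $ 2) * cos \<theta> + (- sin \<theta> * v $ 1 + cos \<theta> * v $ 2) * - sin \<theta>"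
    "v $ 2 = (cos \<theta> * v $ 1 + sin \<theta> * v $ 2) * sin \<theta> + (- sin \<theta> * v $ 1 + cos \<theta> * v $ 2) * cos \<theta>"
    by algebra+
  then show ?thesis
    unfolding vec_eq_iff forall_2 inner_real2 vector_add_component vector_scaleR_component
      dir_nth cos_sin_add_pi_half real_scaleR_def by blast
qed

lemma norm_one_imp_dir:
  fixes v :: "real^2"
  assumes "norm v = 1"
  obtains \<theta> where "v = dir \<theta>"
proof -
  have "(v $ 1)\<^sup>2 + (v $ 2)\<^sup>2 = 1"
    using assms by (simp add: norm_eq_sqrt_inner inner_real2 power2_eq_square)
  then obtain t where "v $ 1 = cos t" "v $ 2 = sin t"
    using sincos_total_2pi by metis
  then show thesis
    using that [of t] by (simp add: vec_eq_iff forall_2)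
qed

lemma diameter_closed_segment: "diameter (closed_segment a b) = dist a b"
  for a b :: "'a::euclidean_space"
proof (rule antisym)
  show "diameter (closed_segment a b) \<le> dist a b"
  proof (rule diameter_le)
    fix x y
    assume x: "x \<in> closed_segment a b" and y: "y \<in> closed_segment a b"
    have "dist y a \<le> dist a b" "dist y b \<le> dist a b"
      using dist_in_closed_segment [OF y] by auto
    then show "norm (x - y) \<le> dist a b"
      using dist_decreases_closed_segment [OF x, of y]
      by (smt (verit) dist_norm dist_commute)
  qed simp
  show "dist a b \<le> diameter (closed_segment a b)"
    by (rule diameter_bounded_bound) (auto simp: bounded_closed_segment)
qed

section \<open>Coordinates along the sides\<close>

context circumscribed_polygon
begin

text \<open>Determined only up to multiples of 2 pi. The choice is harmless: it enters through
  \<open>cos\<close> and \<open>sin\<close>, or through a window of one period centred at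
  it.\<close>

definition normal_angle :: "(real^2) set \<Rightarrow> real" where
  "normal_angle F = (SOME \<theta>. contact F = c + R *\<^sub>R dir \<theta>)"

text \<open>The parameter is the signed distance from the point of contact.\<close>

definition side_point :: "(real^2) set \<Rightarrow> real \<Rightarrow> real^2" where
  "side_point F r = contact F + r *\<^sub>R dir (normal_angle F + pi / 2)"

text \<open>\<open>- lo F\<close> and \<open>hi F\<close> are the lengths of the two parts into
  which the point of contact cuts F.\<close>

definition lo :: "(real^2) set \<Rightarrow> real" where
  "lo F = Inf {r. side_point F r \<in> F}"

definition hi :: "(real^2) set \<Rightarrow> real" where
  "hi F = Sup {r. side_point F r \<in> F}"

lemma contact_eq:
  assumes F: "F facet_of P"
  shows "contact F = c + R *\<^sub>R dir (normal_angle F)"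
proof -
  have "norm ((1 / R) *\<^sub>R (contact F - c)) = 1"
    using norm_contact [OF F] R_pos by simp
  then obtain t where "(1 / R) *\<^sub>R (contact F - c) = dir t"
    using norm_one_imp_dir by blast
  then have "R *\<^sub>R ((1 / R) *\<^sub>R (contact F - c)) = R *\<^sub>R dir t"
    by simp
  then have "contact F = c + R *\<^sub>R dir t"
    using R_pos by (simp add: algebra_simps)
  then show ?thesis
    unfolding normal_angle_def by (rule someI)
qed

lemma affine_hull_facet_eq_side_points:
  assumes F: "F facet_of P"
  shows "affine hull F = range (side_point F)"
proof -
  let ?u = "dir (normal_angle F)" and ?w = "dir (normal_angle F + pi / 2)"
  have "x \<in> range (side_point F)" if "(contact F - c) \<bullet> (x - c) = R\<^sup>2" for x
  proof -
    have "?u \<bullet> (x - c) = R"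
      using that R_pos by (simp add: contact_eq [OF F] power2_eq_square)
    then have "x = side_point F (?w \<bullet> (x - c))"
      using orthogonal_decomposition [of "x - c" "normal_angle F"]
      by (simp add: side_point_def contact_eq [OF F] algebra_simps)
    then show ?thesis by blast
  qed
  moreover have "(contact F - c) \<bullet> (side_point F r - c) = R\<^sup>2" for r
    by (simp add: side_point_def contact_eq [OF F] inner_add_right inner_dir power2_eq_square)
  ultimately show ?thesis
    unfolding affine_hull_facet [OF F] by auto
qed

lemma dist_side_point: "dist (side_point F r) (side_point F s) = \<bar>r - s\<bar>"
  by (simp add: side_point_def dist_norm flip: scaleR_left_diff_distrib)

text \<open>The parameters form the preimage of a compact convex set under an isometric affine map,
  hence a compact interval. It contains 0 because the point of contact belongs to the side; this
  gives the signs of \<open>lo F\<close> and \<open>hi F\<close>.\<close>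

lemma side_points_in_facet:
  assumes F: "F facet_of P"
  shows "{r. side_point F r \<in> F} = {lo F..hi F}" and "lo F \<le> 0" and "0 \<le> hi F"
proof -
  let ?S = "{r. side_point F r \<in> F}"
  have cF: "compact F" and cv: "convex F"
    using face_of_imp_compact [OF convex compact facet_of_imp_face_of [OF F]]
      face_of_imp_convex [OF facet_of_imp_face_of [OF F]] by auto
  have vim: "?S = side_point F -` F" by auto
  have "bounded ?S"
  proof -
    obtain B where B: "\<And>x. x \<in> F \<Longrightarrow> dist (contact F) x \<le> B"
      using compact_imp_bounded [OF cF] bounded_any_center by metis
    have "\<bar>r\<bar> \<le> B" if "r \<in> ?S" for r
      using B [of "side_point F r"] that by (simp add: side_point_def dist_norm)
    then show ?thesis
      by (auto simp: bounded_iff)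
  qed
  moreover have "closed ?S"
    unfolding vim
    by (intro closed_vimage [OF compact_imp_closed [OF cF]]) (auto simp: side_point_def intro!: continuous_intros)
  ultimately have "compact ?S"
    unfolding compact_eq_bounded_closed by blast
  moreover have "convex ?S"
  proof (rule convexI)
    fix r s u v :: real
    assume *: "r \<in> ?S" "s \<in> ?S" "0 \<le> u" "0 \<le> v" "u + v = 1"
    have "side_point F (u *\<^sub>R r + v *\<^sub>R s) = u *\<^sub>R side_point F r + v *\<^sub>R side_point F s"
    proof -
      have "contact F = (u + v) *\<^sub>R contact F"
        using \<open>u + v = 1\<close> by simp
      then show ?thesis
        unfolding side_point_def by (simp add: scaleR_add_left scaleR_add_right)
    qed
    then show "u *\<^sub>R r + v *\<^sub>R s \<in> ?S"
      using * convexD [OF cv] by simp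
  qed
  ultimately obtain a b where ab: "?S = {a..b}"
    using connected_compact_interval_1 connected_convex_1 by metis
  have "0 \<in> ?S"
    using contact_in [OF F] by (simp add: side_point_def)
  with ab have "a \<le> 0" "0 \<le> b" by auto
  then have "lo F = a" "hi F = b"
    by (simp_all add: lo_def hi_def ab)
  then show "?S = {lo F..hi F}" "lo F \<le> 0" "0 \<le> hi F"
    using ab \<open>a \<le> 0\<close> \<open>0 \<le> b\<close> by auto
qed

lemma facet_eq_image:
  assumes F: "F facet_of P"
  shows "F = side_point F ` {lo F..hi F}"
proof -
  have "side_point F ` {r. side_point F r \<in> F} = F \<inter> range (side_point F)"
    by blast
  also have "\<dots> = F"
    using affine_hull_facet_eq_side_points [OF F] hull_subset [of F affine] by auto
  finally show ?thesis
    unfolding side_points_in_facet(1) [OF F] by (rule sym)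
qed

lemma facet_eq_segment:
  assumes F: "F facet_of P"
  shows "F = closed_segment (side_point F (lo F)) (side_point F (hi F))"
proof -
  have "{lo F..hi F} = closed_segment (lo F) (hi F)"
    using side_points_in_facet [OF F] by (simp add: closed_segment_eq_real_ivl)
  moreover have "side_point F ` closed_segment a b = closed_segment (side_point F a) (side_point F b)" for a b
  proof -
    have "side_point F ((1 - u) * a + u * b) = (1 - u) *\<^sub>R side_point F a + u *\<^sub>R side_point F b" for u
      by (simp add: side_point_def algebra_simps)
    then show ?thesis
      by (simp add: closed_segment_image_interval image_image)
  qed
  ultimately have "side_point F ` {lo F..hi F} = closed_segment (side_point F (lo F)) (side_point F (hi F))"
    by simp
  with facet_eq_image [OF F] show ?thesis
    by (rule trans)
qed

lemma diameter_facet: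
  assumes F: "F facet_of P"
  shows "diameter F = hi F - lo F"
proof -
  have "diameter F = dist (side_point F (lo F)) (side_point F (hi F))"
    by (subst facet_eq_segment [OF F]) (rule diameter_closed_segment)
  then show ?thesis
    using side_points_in_facet [OF F] by (simp add: dist_side_point)
qed

lemma perimeter_eq: "perimeter P = (\<Sum>F | F facet_of P. hi F - lo F)"
  unfolding perimeter_def by (rule sum.cong) (auto simp: diameter_facet)

end

subsection \<open>Angles subtended at the centre\<close>

lemma inj_on_dir: "inj_on dir {0..<2 * pi}"
proof (rule inj_onI)
  fix x y
  assume x: "x \<in> {0..<2 * pi}" and y: "y \<in> {0..<2 * pi}" and "dir x = dir y"
  then have "sin y = sin x \<and> cos y = cos x"
    by (metis dir_nth)
  then obtain k :: int where k: "y = x + 2 * pi * k"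
    using sin_cos_eq_iff by blast
  then have "\<bar>2 * pi * k\<bar> < 2 * pi * 1"
    using x y unfolding abs_less_iff atLeastLessThan_iff by linarith
  then have "\<bar>real_of_int k\<bar> < 1"
    by (simp add: abs_mult)
  then have "k = 0" by linarith
  with k show "x = y" by simp
qed

text \<open>Each side is easiest to measure in a window around its own normal direction, but the sum
  needs one window for all. A window is cut at a multiple of p; moving the left piece by one period
  makes it a window that starts at this multiple.\<close>

lemma measure_periodic_Int_window:
  fixes S :: "real set" and a p :: real
  assumes S: "S \<in> sets lebesgue" and p: "p > 0" and periodic: "\<And>x. x + p \<in> S \<longleftrightarrow> x \<in> S"
  shows "measure lebesgue (S \<inter> {a..<a + p}) = measure lebesgue (S \<inter> {0..<p})"
proof -
  have nat: "x + real k * p \<in> S \<longleftrightarrow> x \<in> S" for x k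
  proof (induction k)
    case (Suc k)
    have "x + real (Suc k) * p = (x + real k * p) + p"
      by (simp add: algebra_simps)
    with Suc.IH show ?case
      by (simp only: periodic)
  qed simp
  have int: "x + of_int k * p \<in> S \<longleftrightarrow> x \<in> S" for x and k :: int
  proof (cases k)
    case (nonneg m)
    then show ?thesis by (simp add: nat)
  next
    case (neg m)
    then have "real_of_int k = - real (Suc m)"
      by simp
    then have "x + of_int k * p + real (Suc m) * p = x"
      unfolding \<open>real_of_int k = _\<close> by (simp del: of_nat_Suc)
    then show ?thesis
      using nat [of "x + of_int k * p" "Suc m"] by metis
  qed
  have shift: "measure lebesgue (S \<inter> {u + of_int k * p..<v + of_int k * p}) = measure lebesgue (S \<inter> {u..<v})"
    for u v and k :: int
  proof -
    have "S \<inter> {u + of_int k * p..<v + of_int k * p} = (+) (of_int k * p) ` (S \<inter> {u..<v})"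
    proof (intro equalityI subsetI)
      fix x
      assume "x \<in> S \<inter> {u + of_int k * p..<v + of_int k * p}"
      then have "x - of_int k * p \<in> S \<inter> {u..<v}"
        using int [of "x - of_int k * p" k] by auto
      then show "x \<in> (+) (of_int k * p) ` (S \<inter> {u..<v})"
        by (intro image_eqI [of _ _ "x - of_int k * p"]) auto
    next
      fix x
      assume "x \<in> (+) (of_int k * p) ` (S \<inter> {u..<v})"
      then obtain y where "y \<in> S" "u \<le> y" "y < v" "x = y + of_int k * p"
        by (auto simp: add.commute)
      then show "x \<in> S \<inter> {u + of_int k * p..<v + of_int k * p}"
        by (simp add: int)
    qed
    then show ?thesis
      by (simp add: measure_translation)
  qed
  have meas: "S \<inter> {u..<v} \<in> lmeasurable" for u v
    by (rule bounded_set_imp_lmeasurable) (use S in auto)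
  have split: "measure lebesgue (S \<inter> {u..<w}) = measure lebesgue (S \<inter> {u..<v}) + measure lebesgue (S \<inter> {v..<w})"
    if "u \<le> v" "v \<le> w" for u v w
  proof -
    have "S \<inter> {u..<w} = (S \<inter> {u..<v}) \<union> (S \<inter> {v..<w})"
      using that by auto
    moreover have "(S \<inter> {u..<v}) \<inter> (S \<inter> {v..<w}) = {}"
      by auto
    ultimately show ?thesis
      using measure_Un3 [OF meas meas, of u v v w] by simp
  qed
  \<comment> \<open>b is the least multiple of p that is not below a, so it lies in the
    window.\<close>
  define k where "k = \<lceil>a / p\<rceil>"
  define b where "b = of_int k * p"
  have "a / p \<le> of_int k" "of_int k < a / p + 1"
    unfolding k_def by linarith+
  then have b: "a \<le> b" "b \<le> a + p"
    using p by (auto simp: b_def field_simps)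
  have "measure lebesgue (S \<inter> {a..<a + p}) = measure lebesgue (S \<inter> {a..<b}) + measure lebesgue (S \<inter> {b..<a + p})"
    using b by (rule split)
  also have "measure lebesgue (S \<inter> {a..<b}) = measure lebesgue (S \<inter> {a + p..<b + p})"
    using shift [of a 1 b] by simp
  also have "measure lebesgue (S \<inter> {a + p..<b + p}) + measure lebesgue (S \<inter> {b..<a + p})
      = measure lebesgue (S \<inter> {b..<b + p})"
    using split [of b "a + p" "b + p"] b by simp
  also have "\<dots> = measure lebesgue (S \<inter> {0..<p})"
    using shift [of 0 k p] by (simp add: b_def add.commute)
  finally show ?thesis .
qed

context circumscribed_polygon
begin

text \<open>
  Directions in which F is seen from c. Reading the angles of all the sides as Lebesgue measures in
  one period makes them add up to 2 pi without ordering the sides around the circle.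
\<close>

definition sector :: "(real^2) set \<Rightarrow> real set" where
  "sector F = {\<theta>. \<exists>s>0. c + s *\<^sub>R dir \<theta> \<in> F}"

text \<open>In the frame of normal and tangent at the point of contact, the point at distance s in
  direction \<theta> has coordinates s cos and s sin of the angle difference. It is on the line iff
  s cos = R, and its parameter is then R tan. Multiplying by the positive cosine removes the
  division, which makes measurability immediate.\<close>

lemma sector_iff:
  assumes F: "F facet_of P"
  shows "\<theta> \<in> sector F \<longleftrightarrow> cos (\<theta> - normal_angle F) > 0 \<and>
    lo F * cos (\<theta> - normal_angle F) \<le> R * sin (\<theta> - normal_angle F) \<and>
    R * sin (\<theta> - normal_angle F) \<le> hi F * cos (\<theta> - normal_angle F)"
proof -
  let ?\<phi> = "normal_angle F"
  define C S where "C = cos (\<theta> - ?\<phi>)" and "S = sin (\<theta> - ?\<phi>)"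
  have mem: "c + s *\<^sub>R dir \<theta> \<in> F \<longleftrightarrow> (\<exists>r\<in>{lo F..hi F}. s * C = R \<and> s * S = r)" for s
  proof -
    have "c + s *\<^sub>R dir \<theta> = side_point F r \<longleftrightarrow> s * C = R \<and> s * S = r" for r
    proof
      assume *: "c + s *\<^sub>R dir \<theta> = side_point F r"
      have "s *\<^sub>R dir \<theta> = R *\<^sub>R dir ?\<phi> + r *\<^sub>R dir (?\<phi> + pi / 2)"
        using * by (simp add: side_point_def contact_eq [OF F] add.assoc)
      then have "dir ?\<phi> \<bullet> (s *\<^sub>R dir \<theta>) = dir ?\<phi> \<bullet> (R *\<^sub>R dir ?\<phi> + r *\<^sub>R dir (?\<phi> + pi / 2))"
        "dir (?\<phi> + pi / 2) \<bullet> (s *\<^sub>R dir \<theta>) = dir (?\<phi> + pi / 2) \<bullet> (R *\<^sub>R dir ?\<phi> + r *\<^sub>R dir (?\<phi> + pi / 2))"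
        by simp_all
      moreover have "cos (?\<phi> - \<theta>) = C" "cos (?\<phi> + pi / 2 - \<theta>) = S"
        unfolding C_def S_def using cos_minus [of "\<theta> - ?\<phi>"] sin_minus [of "\<theta> - ?\<phi>"]
          cos_sin_add_pi_half(1) [of "?\<phi> - \<theta>"]
        by (simp_all add: algebra_simps)
      ultimately show "s * C = R \<and> s * S = r"
        by (simp add: inner_add_right inner_dir)
    next
      assume *: "s * C = R \<and> s * S = r"
      have "s *\<^sub>R dir \<theta> = s *\<^sub>R (C *\<^sub>R dir ?\<phi> + S *\<^sub>R dir (?\<phi> + pi / 2))"
        unfolding C_def S_def dir_eq_combination [of \<theta> ?\<phi>, symmetric] ..
      also have "\<dots> = R *\<^sub>R dir ?\<phi> + r *\<^sub>R dir (?\<phi> + pi / 2)"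
        using * by (simp add: scaleR_add_right)
      finally show "c + s *\<^sub>R dir \<theta> = side_point F r"
        unfolding side_point_def contact_eq [OF F] add.assoc by (rule arg_cong)
    qed
    then show ?thesis
      using facet_eq_image [OF F] by (metis (no_types, lifting) imageE image_eqI)
  qed
  show ?thesis
  proof
    assume "\<theta> \<in> sector F"
    then obtain s where s: "s > 0" "s * C = R" "lo F \<le> s * S" "s * S \<le> hi F"
      using mem by (auto simp: sector_def)
    then have "C > 0"
      using R_pos by (metis zero_less_mult_pos)
    moreover have "lo F * C \<le> s * S * C" "s * S * C \<le> hi F * C"
      using s \<open>C > 0\<close> by (auto intro: mult_right_mono)
    moreover have "s * S * C = R * S"
      using s by (simp add: mult.assoc mult.left_commute mult.commute)
    ultimately have "C > 0 \<and> lo F * C \<le> R * S \<and> R * S \<le> hi F * C"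
      by metis
    then show "cos (\<theta> - ?\<phi>) > 0 \<and> lo F * cos (\<theta> - ?\<phi>) \<le> R * sin (\<theta> - ?\<phi>)
        \<and> R * sin (\<theta> - ?\<phi>) \<le> hi F * cos (\<theta> - ?\<phi>)"
      by (simp add: C_def S_def)
  next
    assume "cos (\<theta> - ?\<phi>) > 0 \<and> lo F * cos (\<theta> - ?\<phi>) \<le> R * sin (\<theta> - ?\<phi>)
        \<and> R * sin (\<theta> - ?\<phi>) \<le> hi F * cos (\<theta> - ?\<phi>)"
    then have *: "C > 0" "lo F * C \<le> R * S" "R * S \<le> hi F * C"
      by (auto simp: C_def S_def)
    then have "R / C * C = R" "R / C * S \<in> {lo F..hi F}" "R / C > 0"
      using R_pos by (auto simp: field_simps)
    then have "c + (R / C) *\<^sub>R dir \<theta> \<in> F" "R / C > 0"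
      unfolding mem by blast+
    then show "\<theta> \<in> sector F"
      unfolding sector_def by blast
  qed
qed

text \<open>Within pi / 2 of the normal direction the conditions bound the tangent by
  \<open>lo F / R\<close> and \<open>hi F / R\<close>, and the monotone \<open>arctan\<close>
  inverts them. In the rest of the window the cosine is not positive.\<close>

lemma sector_Int_window:
  assumes F: "F facet_of P"
  shows "sector F \<inter> {normal_angle F - pi..<normal_angle F - pi + 2 * pi}
    = {normal_angle F + arctan (lo F / R)..normal_angle F + arctan (hi F / R)}"
proof -
  have "normal_angle F + \<delta> \<in> sector F \<inter> {normal_angle F - pi..<normal_angle F - pi + 2 * pi}
    \<longleftrightarrow> normal_angle F + \<delta> \<in> {normal_angle F + arctan (lo F / R)..normal_angle F + arctan (hi F / R)}" for \<delta>
  proof (cases "\<bar>\<delta>\<bar> < pi / 2")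
    case True
    then have cos: "cos \<delta> > 0" and at: "arctan (tan \<delta>) = \<delta>"
      by (auto intro!: cos_gt_zero_pi arctan_tan)
    have "arctan (lo F / R) \<le> \<delta> \<longleftrightarrow> lo F / R \<le> tan \<delta>" "\<delta> \<le> arctan (hi F / R) \<longleftrightarrow> tan \<delta> \<le> hi F / R"
      by (metis arctan_le_iff at)+
    then show ?thesis
      using True cos R_pos pi_gt_zero by (auto simp: sector_iff [OF F] tan_def field_simps)
  next
    case False
    have "cos \<delta> \<le> 0" if "- pi \<le> \<delta>" "\<delta> < pi"
    proof -
      have "cos \<bar>\<delta>\<bar> \<le> cos (pi / 2)"
        using False that by (intro cos_monotone_0_pi_le) auto
      then show ?thesis by simp
    qed
    moreover have "\<not> (arctan (lo F / R) \<le> \<delta> \<and> \<delta> \<le> arctan (hi F / R))"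
      using False arctan_bounded [of "lo F / R"] arctan_bounded [of "hi F / R"] by auto
    ultimately show ?thesis
      by (auto simp: sector_iff [OF F])
  qed
  from this [of "x - normal_angle F" for x] have "x \<in> sector F \<inter> {normal_angle F - pi..<normal_angle F - pi + 2 * pi}
    \<longleftrightarrow> x \<in> {normal_angle F + arctan (lo F / R)..normal_angle F + arctan (hi F / R)}" for x
    unfolding add_diff_eq add_diff_cancel_left' .
  then show ?thesis by blast
qed

lemma sector_measurable:
  assumes F: "F facet_of P"
  shows "sector F \<in> sets lebesgue"
proof -
  have "sector F = {\<theta>. cos (\<theta> - normal_angle F) > 0 \<and>
    lo F * cos (\<theta> - normal_angle F) \<le> R * sin (\<theta> - normal_angle F) \<and>
    R * sin (\<theta> - normal_angle F) \<le> hi F * cos (\<theta> - normal_angle F)}"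
    using sector_iff [OF F] by blast
  also have "\<dots> \<in> sets borel"
    by measurable
  finally show ?thesis
    by (simp add: sets_completionI_sets)
qed

lemma measure_sector:
  assumes F: "F facet_of P"
  shows "measure lebesgue (sector F \<inter> {0..<2 * pi}) = arctan (hi F / R) - arctan (lo F / R)"
proof -
  have "x + 2 * pi \<in> sector F \<longleftrightarrow> x \<in> sector F" for x
    by (simp add: sector_def dir_def)
  then have "measure lebesgue (sector F \<inter> {0..<2 * pi})
      = measure lebesgue (sector F \<inter> {normal_angle F - pi..<normal_angle F - pi + 2 * pi})"
    by (intro measure_periodic_Int_window [symmetric] sector_measurable F) simp_all
  also have "\<dots> = arctan (hi F / R) - arctan (lo F / R)"
  proof -
    have "arctan (lo F / R) \<le> arctan (hi F / R)"
      unfolding arctan_le_iff using side_points_in_facet [OF F] R_pos by (simp add: divide_right_mono)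
    then show ?thesis
      unfolding sector_Int_window [OF F] by simp
  qed
  finally show ?thesis .
qed

text \<open>Every ray from c meets a side, so the sectors cover a full period. A direction shared by
  two sectors points to a common point of the two sides; there is at most one such point, hence at
  most one such direction in a period.\<close>

lemma sum_arctan: "(\<Sum>F | F facet_of P. arctan (hi F / R) - arctan (lo F / R)) = 2 * pi"
proof -
  have "negligible ((sector F \<inter> {0..<2 * pi}) \<inter> (sector G \<inter> {0..<2 * pi}))"
    if F: "F facet_of P" and G: "G facet_of P" and "F \<noteq> G" for F G
  proof -
    have pt: "\<exists>s>0. c + s *\<^sub>R dir \<theta> \<in> F \<inter> G" if \<theta>: "\<theta> \<in> sector F \<inter> sector G" for \<theta>
    proof -
      obtain s t where st: "s > 0" "t > 0" "c + s *\<^sub>R dir \<theta> \<in> F" "c + t *\<^sub>R dir \<theta> \<in> G"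
        using \<theta> unfolding sector_def by blast
      \<comment> \<open>Both points lie on one ray from c: the factors \<open>1 / s\<close> and
        \<open>1 / t\<close> scale them to the same unit vector.\<close>
      have "s *\<^sub>R dir \<theta> = t *\<^sub>R dir \<theta>"
        by (rule scaled_facet_points_eq [OF F G, of _ _ "1 / s" "1 / t"]) (use st in auto)
      then have "c + s *\<^sub>R dir \<theta> \<in> F \<inter> G"
        using st(3,4) by simp
      with st(1) show ?thesis by blast
    qed
    have "\<theta> = \<psi>" if \<theta>: "\<theta> \<in> sector F \<inter> sector G" "\<theta> \<in> {0..<2 * pi}" and \<psi>: "\<psi> \<in> sector F \<inter> sector G" "\<psi> \<in> {0..<2 * pi}" for \<theta> \<psi>
    proof -
      obtain s t where st: "s > 0" "t > 0" "c + s *\<^sub>R dir \<theta> \<in> F \<inter> G" "c + t *\<^sub>R dir \<psi> \<in> F \<inter> G"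
        using pt [OF \<theta>(1)] pt [OF \<psi>(1)] by blast
      then have eq: "s *\<^sub>R dir \<theta> = t *\<^sub>R dir \<psi>"
        using facet_Int_unique [OF F G \<open>F \<noteq> G\<close> st(3,4)] by simp
      then have "norm (s *\<^sub>R dir \<theta>) = norm (t *\<^sub>R dir \<psi>)" by simp
      with st have "s = t" by simp
      with eq st have "dir \<theta> = dir \<psi>" by simp
      then show ?thesis
        using inj_onD [OF inj_on_dir] \<theta>(2) \<psi>(2) by blast
    qed
    then have "(sector F \<inter> {0..<2 * pi}) \<inter> (sector G \<inter> {0..<2 * pi}) = {} \<or>
        (\<exists>\<theta>. (sector F \<inter> {0..<2 * pi}) \<inter> (sector G \<inter> {0..<2 * pi}) = {\<theta>})"
      by blast
    then show ?thesis
      by auto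
  qed
  then have "measure lebesgue (\<Union>F\<in>{F. F facet_of P}. sector F \<inter> {0..<2 * pi})
      = (\<Sum>F | F facet_of P. measure lebesgue (sector F \<inter> {0..<2 * pi}))"
    by (intro measure_negligible_finite_Union_image finite_facets bounded_set_imp_lmeasurable)
      (auto simp: pairwise_def sector_measurable)
  also have "(\<Union>F\<in>{F. F facet_of P}. sector F \<inter> {0..<2 * pi}) = {0..<2 * pi}"
  proof -
    have "\<exists>F. F facet_of P \<and> \<theta> \<in> sector F" for \<theta>
      unfolding sector_def mem_Collect_eq by (rule ray_meets_facet [OF dir_nonzero]) blast
    then show ?thesis by blast
  qed
  finally show ?thesis
    by (simp add: measure_sector)
qed

end

subsection \<open>Area and perimeter\<close>

text \<open>By the mean value theorem the chord has slope 1 / (1 + z^2) for some z strictly between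
  a and x. On nonnegative numbers this slope is strictly decreasing in z, so the bound is strict
  away from a.\<close>

lemma arctan_le_tangent:
  fixes x a :: real
  assumes "x \<ge> 0" "a \<ge> 0"
  shows "arctan x \<le> arctan a + (x - a) / (1 + a\<^sup>2)"
    and "arctan x = arctan a + (x - a) / (1 + a\<^sup>2) \<Longrightarrow> x = a"
proof -
  have "arctan x < arctan a + (x - a) / (1 + a\<^sup>2)" if "x \<noteq> a"
  proof (cases "a < x")
    case True
    obtain z where z: "a < z" "z < x" "arctan x - arctan a = (x - a) * inverse (1 + z\<^sup>2)"
      using MVT2 [OF True, of arctan "\<lambda>z. inverse (1 + z\<^sup>2)"] DERIV_arctan by blast
    have "a\<^sup>2 < z\<^sup>2"
      using z assms by (intro power_strict_mono) auto
    then have "inverse (1 + z\<^sup>2) < inverse (1 + a\<^sup>2)"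
      by (intro less_imp_inverse_less) (auto simp: add_pos_nonneg)
    then have "(x - a) * inverse (1 + z\<^sup>2) < (x - a) * inverse (1 + a\<^sup>2)"
      using True by (intro mult_strict_left_mono) auto
    with z(3) show ?thesis
      unfolding divide_inverse by linarith
  next
    case False
    then have "x < a" using that by simp
    then obtain z where z: "x < z" "z < a" "arctan a - arctan x = (a - x) * inverse (1 + z\<^sup>2)"
      using MVT2 [OF \<open>x < a\<close>, of arctan "\<lambda>z. inverse (1 + z\<^sup>2)"] DERIV_arctan by blast
    have "z\<^sup>2 < a\<^sup>2"
      using z assms by (intro power_strict_mono) auto
    then have "inverse (1 + a\<^sup>2) < inverse (1 + z\<^sup>2)"
      by (intro less_imp_inverse_less) (auto simp: add_pos_nonneg)
    then have "(a - x) * inverse (1 + a\<^sup>2) < (a - x) * inverse (1 + z\<^sup>2)"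
      using \<open>x < a\<close> by (intro mult_strict_left_mono) auto
    moreover have "(a - x) * inverse (1 + a\<^sup>2) = - ((x - a) / (1 + a\<^sup>2))"
      by (simp add: divide_inverse left_diff_distrib)
    ultimately show ?thesis
      using z(3) by linarith
  qed
  then show "arctan x \<le> arctan a + (x - a) / (1 + a\<^sup>2)"
    and "arctan x = arctan a + (x - a) / (1 + a\<^sup>2) \<Longrightarrow> x = a"
    by fastforce+
qed

text \<open>
  Here w is the point of intersection of the tangents at p and q to the circle about 0: the half angle
  at w has tangent R / norm (p - w).
\<close>

lemma cos_angle_between_tangents:
  fixes p q w :: "real^2"
  assumes p: "norm p = R" and q: "norm q = R" and pw: "p \<bullet> w = R\<^sup>2" and qw: "q \<bullet> w = R\<^sup>2"
    and "p \<noteq> q" and "p \<noteq> w"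
  shows "((p - w) \<bullet> (q - w)) / (norm (p - w) * norm (q - w))
    = ((norm (p - w))\<^sup>2 - R\<^sup>2) / ((norm (p - w))\<^sup>2 + R\<^sup>2)"
proof -
  define W t where "W = w \<bullet> w" and "t = norm (p - w)"
  have pp: "p \<bullet> p = R\<^sup>2" and qq: "q \<bullet> q = R\<^sup>2"
    using p q by (auto simp: dot_square_norm)
  have t: "t\<^sup>2 = W - R\<^sup>2" and tq: "(norm (q - w))\<^sup>2 = W - R\<^sup>2"
    by (simp_all add: t_def W_def power2_norm_eq_inner inner_diff_left inner_diff_right
        inner_commute [of w p] inner_commute [of w q] pp qq pw qw)
  have "t > 0"
    using \<open>p \<noteq> w\<close> by (simp add: t_def)
  have tq: "norm (q - w) = t"
    using t tq \<open>t > 0\<close> by (metis norm_ge_zero order_less_imp_le power2_eq_imp_eq)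
  \<comment> \<open>x is nonzero and orthogonal to both w and y. In the plane this makes w and y
    parallel, so Cauchy-Schwarz for y and w is an equality, and this equality determines
    \<open>p \<bullet> q\<close>.\<close>
  define x y where "x = p - q" and "y = p + q"
  have xw: "x $ 1 * w $ 1 + x $ 2 * w $ 2 = 0"
    unfolding inner_real2 [symmetric] x_def by (simp add: inner_diff_left pw qw)
  have xy: "x $ 1 * y $ 1 + x $ 2 * y $ 2 = 0"
    unfolding inner_real2 [symmetric] x_def y_def
    by (simp add: inner_diff_left inner_add_right inner_commute [of q p] pp qq)
  have "x $ 1 * (w $ 1 * y $ 2 - w $ 2 * y $ 1) = 0" "x $ 2 * (w $ 1 * y $ 2 - w $ 2 * y $ 1) = 0"
    using xw xy by algebra+
  moreover have "x $ 1 \<noteq> 0 \<or> x $ 2 \<noteq> 0"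
    using \<open>p \<noteq> q\<close> by (auto simp: x_def vec_eq_iff forall_2)
  ultimately have "w $ 1 * y $ 2 - w $ 2 * y $ 1 = 0"
    by auto
  then have "(y \<bullet> w)\<^sup>2 = (y \<bullet> y) * (w \<bullet> w)"
    unfolding inner_real2 by algebra
  moreover have "y \<bullet> w = 2 * R\<^sup>2" "y \<bullet> y = 2 * R\<^sup>2 + 2 * (p \<bullet> q)"
    by (simp_all add: y_def inner_add_left inner_add_right pw qw pp qq inner_commute)
  ultimately have "(2 * R\<^sup>2)\<^sup>2 = (2 * R\<^sup>2 + 2 * (p \<bullet> q)) * W"
    by (simp add: W_def)
  moreover have W: "W = t\<^sup>2 + R\<^sup>2"
    using t by simp
  moreover have "(p - w) \<bullet> (q - w) = p \<bullet> q + t\<^sup>2 - R\<^sup>2"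
    using W by (simp add: W_def inner_diff_left inner_diff_right inner_commute [of w p] inner_commute [of w q] pw qw)
  ultimately have "((p - w) \<bullet> (q - w)) * (t\<^sup>2 + R\<^sup>2) = (t\<^sup>2 - R\<^sup>2) * (t * t)"
    by algebra
  moreover have "t\<^sup>2 + R\<^sup>2 \<noteq> 0" "t * t \<noteq> 0"
    using \<open>t > 0\<close> by (auto simp: add_nonneg_eq_0_iff)
  ultimately show ?thesis
    unfolding tq t_def [symmetric] by (simp add: frac_eq_eq)
qed

context circumscribed_polygon
begin

text \<open>The side is the base, and the radius to the point of contact is the height.\<close>

lemma measure_triangle:
  assumes F: "F facet_of P"
  shows "measure lebesgue (convex hull (insert c F)) = R * (hi F - lo F) / 2"
    and "convex hull (insert c F) \<in> lmeasurable"
proof -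
  let ?A = "side_point F (lo F)" and ?B = "side_point F (hi F)" and ?\<phi> = "normal_angle F"
  have hull: "convex hull (insert c F) = convex hull {c, ?A, ?B}"
    by (subst facet_eq_segment [OF F]) (simp only: segment_convex_hull hull_insert [of convex, symmetric])
  have "compact (convex hull {c, ?A, ?B})"
    by (intro compact_convex_hull finite_imp_compact) simp
  then show "convex hull (insert c F) \<in> lmeasurable"
    unfolding hull by (rule lmeasurable_compact)
  have "measure lebesgue (convex hull {c, ?A, ?B}) = measure lborel (convex hull {c, ?A, ?B})"
    using \<open>compact (convex hull {c, ?A, ?B})\<close> by (intro measure_completion) (simp add: borel_compact)
  also have "\<dots> = \<bar>(?B $ 1 - c $ 1) * (?A $ 2 - c $ 2) - (?A $ 1 - c $ 1) * (?B $ 2 - c $ 2)\<bar> / 2"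
    by (rule content_triangle)
  \<comment> \<open>The factor cos^2 + sin^2 is kept so that the identity is purely
    polynomial.\<close>
  also have "(?B $ 1 - c $ 1) * (?A $ 2 - c $ 2) - (?A $ 1 - c $ 1) * (?B $ 2 - c $ 2)
      = R * (lo F - hi F) * (cos ?\<phi> * cos ?\<phi> + sin ?\<phi> * sin ?\<phi>)"
    unfolding side_point_def contact_eq [OF F] vector_add_component vector_scaleR_component dir_nth
      cos_sin_add_pi_half real_scaleR_def
    by algebra
  also have "\<bar>R * (lo F - hi F) * (cos ?\<phi> * cos ?\<phi> + sin ?\<phi> * sin ?\<phi>)\<bar> = R * (hi F - lo F)"
    using R_pos side_points_in_facet(2,3) [OF F] by (simp add: sin_cos_squared_add3 abs_mult)
  finally show "measure lebesgue (convex hull (insert c F)) = R * (hi F - lo F) / 2"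
    unfolding hull .
qed

lemma in_triangle_iff:
  assumes F: "F facet_of P"
  shows "x \<in> convex hull (insert c F) \<longleftrightarrow> (\<exists>f s. f \<in> F \<and> 0 \<le> s \<and> s \<le> 1 \<and> x = c + s *\<^sub>R (f - c))"
proof -
  have "F \<noteq> {}" "convex hull F = F"
    using contact_in [OF F] face_of_imp_convex [OF facet_of_imp_face_of [OF F]]
    by (auto simp: convex_hull_eq)
  then show ?thesis
    by (auto simp: convex_hull_insert_segments in_segment algebra_simps)
qed

text \<open>The triangles with apex c over the sides tile P; two of them overlap at most in the line
  through c and the common endpoint of their sides.\<close>

lemma area_eq: "area P = R * perimeter P / 2"
proof -
  have "negligible (convex hull (insert c F) \<inter> convex hull (insert c G))"
    if F: "F facet_of P" and G: "G facet_of P" and "F \<noteq> G" for F G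
  proof -
    \<comment> \<open>If the sides are disjoint, any v will do.\<close>
    obtain v where v: "F \<inter> G \<subseteq> {v}"
      using facet_Int_unique [OF F G \<open>F \<noteq> G\<close>] by (cases "F \<inter> G = {}") blast+
    have "x \<in> affine hull {c, v}" if xF: "x \<in> convex hull (insert c F)" and xG: "x \<in> convex hull (insert c G)" for x
    proof (cases "x = c")
      case False
      obtain f s where f: "f \<in> F" "0 \<le> s" "x = c + s *\<^sub>R (f - c)"
        using xF in_triangle_iff [OF F] by blast
      obtain g t where g: "g \<in> G" "0 \<le> t" "x = c + t *\<^sub>R (g - c)"
        using xG in_triangle_iff [OF G] by blast
      have "s > 0" "t > 0"
        using False f(2,3) g(2,3) by (auto simp: less_le)
      have "f - c = g - c"
        by (rule scaled_facet_points_eq [OF F G, of _ _ s t]) (use f g \<open>s > 0\<close> \<open>t > 0\<close> in auto)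
      then have "f = v"
        using f(1) g(1) v by auto
      then have "x = (1 - s) *\<^sub>R c + s *\<^sub>R v"
        using f(3) by (simp add: algebra_simps)
      then show ?thesis
        unfolding affine_hull_2 mem_Collect_eq by (intro exI [of _ "1 - s"] exI [of _ s]) simp
    qed (simp add: hull_inc)
    moreover have "negligible (affine hull {c, v})"
      by (rule negligible_convex_interior [THEN iffD2])
        (auto simp: affine_imp_convex intro!: low_dim_interior split: if_splits)
    ultimately show ?thesis
      by (auto intro: negligible_subset)
  qed
  then have "measure lebesgue (\<Union>F\<in>{F. F facet_of P}. convex hull (insert c F))
      = (\<Sum>F | F facet_of P. measure lebesgue (convex hull (insert c F)))"
    by (intro measure_negligible_finite_Union_image finite_facets)
      (auto simp: pairwise_def measure_triangle)
  also have "(\<Union>F\<in>{F. F facet_of P}. convex hull (insert c F)) = P"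
  proof (intro equalityI subsetI)
    fix x
    assume "x \<in> (\<Union>F\<in>{F. F facet_of P}. convex hull (insert c F))"
    moreover have "convex hull (insert c F) \<subseteq> P" if "F facet_of P" for F
      using facet_of_imp_subset [OF that] center_in_interior interior_subset convex
      by (intro hull_minimal) auto
    ultimately show "x \<in> P" by blast
  next
    fix x
    assume x: "x \<in> P"
    show "x \<in> (\<Union>F\<in>{F. F facet_of P}. convex hull (insert c F))"
    proof (cases "x = c")
      case True
      have "\<exists>F. F facet_of P"
        using ray_meets_facet [OF dir_nonzero [of 0]] by blast
      with True show ?thesis
        by (auto intro: hull_inc)
    next
      case False
      then obtain F s where F: "F facet_of P" and s: "s > 0" "c + s *\<^sub>R (x - c) \<in> F"
        using ray_meets_facet [of "x - c"] by auto
      \<comment> \<open>The ray through x leaves P at the factor s. Comparing the functional of F at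
        x and at the exit point gives s \<ge> 1, so x lies between c and the exit point, with
        coefficient \<open>1 / s\<close>.\<close>
      have "s * ((contact F - c) \<bullet> (x - c)) = R\<^sup>2"
        using inner_facet [OF F s(2)] by simp
      also have "R\<^sup>2 \<ge> (contact F - c) \<bullet> (x - c)"
        by (rule inner_le [OF F x])
      finally have le: "(contact F - c) \<bullet> (x - c) \<le> s * ((contact F - c) \<bullet> (x - c))" .
      have "(contact F - c) \<bullet> (x - c) > 0"
        using \<open>s * _ = R\<^sup>2\<close> R_pos s(1) by (metis zero_less_mult_pos zero_less_power)
      with le have "1 \<le> s" by simp
      then have "x \<in> convex hull (insert c F)"
        unfolding in_triangle_iff [OF F] using s
        by (intro exI [of _ "c + s *\<^sub>R (x - c)"] exI [of _ "1 / s"]) auto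
      then show ?thesis using F by blast
    qed
  qed
  finally show ?thesis
    by (simp add: area_def measure_triangle perimeter_eq flip: sum_distrib_left sum_divide_distrib)
qed

text \<open>The sides are seen from c under angles less than pi with sum 2 pi, so two sides are not
  enough.\<close>

lemma n_ge_3: "n \<ge> 3"
proof -
  have ne: "{F. F facet_of P} \<noteq> {}"
    using ray_meets_facet [OF dir_nonzero [of 0]] by blast
  have "2 * pi = (\<Sum>F | F facet_of P. arctan (hi F / R) - arctan (lo F / R))"
    by (rule sum_arctan [symmetric])
  also have "\<dots> < (\<Sum>F | F facet_of P. pi)"
  proof (rule sum_strict_mono [OF finite_facets ne])
    fix F
    show "arctan (hi F / R) - arctan (lo F / R) < pi"
      using arctan_bounded [of "hi F / R"] arctan_bounded [of "lo F / R"] by linarith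
  qed
  also have "\<dots> = n * pi"
    by (simp add: card_facets)
  finally show ?thesis by simp
qed

lemma perimeter_ge: "perimeter P \<ge> 2 * R * (n * tan (pi / n))"
  and perimeter_eq_iff: "perimeter P = 2 * R * (n * tan (pi / n)) \<longleftrightarrow>
    (\<forall>F. F facet_of P \<longrightarrow> hi F = R * tan (pi / n) \<and> lo F = - (R * tan (pi / n)))"
proof -
  define \<tau> where "\<tau> = tan (pi / n)"
  have n: "real n \<ge> 3"
    using n_ge_3 by simp
  have "0 < pi / n" "pi / n < pi / 2"
    using n pi_gt_zero by (auto simp: field_simps)
  then have "\<tau> > 0" and at: "arctan \<tau> = pi / n"
    by (auto simp: \<tau>_def tan_gt_zero arctan_tan)
  \<comment> \<open>e is the gap in the tangent-line bound at \<tau>, and D adds the gaps of the two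
    parts of a side. As the angles have a fixed sum, the gaps total a positive multiple of the
    excess of the perimeter; the inequality and its equality case are then those of a sum of
    nonnegative terms.\<close>
  define e where "e x = arctan \<tau> + (x - \<tau>) / (1 + \<tau>\<^sup>2) - arctan x" for x
  have e_nonneg: "e x \<ge> 0" and e_zero: "e x = 0 \<longleftrightarrow> x = \<tau>" if "x \<ge> 0" for x
    using arctan_le_tangent [OF that, of \<tau>] \<open>\<tau> > 0\<close> by (auto simp: e_def)
  define D where "D F = e (hi F / R) + e (- lo F / R)" for F
  have pos: "hi F / R \<ge> 0" "- lo F / R \<ge> 0" if "F facet_of P" for F
    using side_points_in_facet(2,3) [OF that] R_pos by (auto simp: divide_le_0_iff)
  have "D F \<ge> 0" if "F facet_of P" for F
    using e_nonneg pos [OF that] by (simp add: D_def)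
  moreover have "D F = 0 \<longleftrightarrow> hi F = R * \<tau> \<and> lo F = - (R * \<tau>)" if "F facet_of P" for F
  proof -
    have "D F = 0 \<longleftrightarrow> hi F / R = \<tau> \<and> - lo F / R = \<tau>"
      using e_nonneg e_zero pos [OF that] by (simp add: D_def add_nonneg_eq_0_iff)
    then show ?thesis
      using R_pos by (auto simp: field_simps)
  qed
  moreover have "(\<Sum>F | F facet_of P. D F) = (perimeter P - 2 * R * (n * \<tau>)) / (R * (1 + \<tau>\<^sup>2))"
  proof -
    have "D F = (2 * (pi / n) - 2 * \<tau> / (1 + \<tau>\<^sup>2)) + (hi F - lo F) / (R * (1 + \<tau>\<^sup>2))
        - (arctan (hi F / R) - arctan (lo F / R))" for F
    proof -
      have "(hi F / R - \<tau>) / (1 + \<tau>\<^sup>2) + (- lo F / R - \<tau>) / (1 + \<tau>\<^sup>2)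
          = (hi F - lo F) / (R * (1 + \<tau>\<^sup>2)) - 2 * \<tau> / (1 + \<tau>\<^sup>2)"
        by (simp add: diff_divide_distrib add_divide_distrib)
      then show ?thesis
        unfolding D_def e_def at by (simp add: arctan_minus)
    qed
    then have "(\<Sum>F | F facet_of P. D F) = n * (2 * (pi / n) - 2 * \<tau> / (1 + \<tau>\<^sup>2))
        + perimeter P / (R * (1 + \<tau>\<^sup>2)) - 2 * pi"
      using sum_arctan
      by (simp add: sum.distrib sum_subtractf card_facets perimeter_eq flip: sum_divide_distrib)
    also have "\<dots> = perimeter P / (R * (1 + \<tau>\<^sup>2)) - 2 * n * \<tau> / (1 + \<tau>\<^sup>2)"
      using n by (simp add: right_diff_distrib)
    also have "2 * n * \<tau> / (1 + \<tau>\<^sup>2) = 2 * R * (n * \<tau>) / (R * (1 + \<tau>\<^sup>2))"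
      using R_pos by simp
    finally show ?thesis
      by (simp only: diff_divide_distrib)
  qed
  moreover have "R * (1 + \<tau>\<^sup>2) > 0"
    using R_pos by (simp add: add_pos_nonneg)
  moreover have "(\<Sum>F | F facet_of P. D F) \<ge> 0"
    by (rule sum_nonneg) (use \<open>\<And>F. F facet_of P \<Longrightarrow> D F \<ge> 0\<close> in auto)
  moreover have "(\<Sum>F | F facet_of P. D F) = 0 \<longleftrightarrow> (\<forall>F. F facet_of P \<longrightarrow> D F = 0)"
    using sum_nonneg_eq_0_iff [OF finite_facets] \<open>\<And>F. F facet_of P \<Longrightarrow> D F \<ge> 0\<close> by auto
  ultimately show "perimeter P \<ge> 2 * R * (n * tan (pi / n))"
    and "perimeter P = 2 * R * (n * tan (pi / n)) \<longleftrightarrow>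
      (\<forall>F. F facet_of P \<longrightarrow> hi F = R * tan (pi / n) \<and> lo F = - (R * tan (pi / n)))"
    unfolding \<tau>_def [symmetric] by (auto simp: zero_le_divide_iff)
qed

subsection \<open>Regularity\<close>

text \<open>Otherwise two vectors of length R would have inner product R^2 and hence be equal. It
  follows that no point of contact is a vertex, so tangent lengths are positive.\<close>

lemma contact_not_in_other_facet:
  assumes F: "F facet_of P" and G: "G facet_of P" and "F \<noteq> G"
  shows "contact F \<notin> G"
proof
  assume "contact F \<in> G"
  then have "(contact G - c) \<bullet> (contact F - c) = R\<^sup>2"
    by (rule inner_facet [OF G])
  then have "((contact F - c) - (contact G - c)) \<bullet> ((contact F - c) - (contact G - c)) = 0"
    unfolding inner_diff_left [of "contact F - c"] inner_diff_right [of _ "contact F - c"]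
      inner_commute [of "contact F - c" "contact G - c"] inner_contact [OF F] inner_contact [OF G]
    by simp
  then have "contact F = contact G"
    by simp
  then show False
    using contact_inj [OF F G] \<open>F \<noteq> G\<close> by simp
qed

lemma extreme_point_of_facet:
  assumes F: "F facet_of P"
  shows "v extreme_point_of F \<longleftrightarrow> v = side_point F (lo F) \<or> v = side_point F (hi F)"
  by (subst (1) facet_eq_segment [OF F]) (rule extreme_point_of_segment)

lemma facet_eq_segment_from_vertex:
  assumes F: "F facet_of P" and v: "v extreme_point_of F"
  obtains a where "F = closed_segment v a"
  using v facet_eq_segment [OF F] closed_segment_commute unfolding extreme_point_of_facet [OF F] by metis

text \<open>A proper face of a polyhedron is the intersection of the facets containing it; if F were
  the only one through v, it would be the single point v. This ensures that the angle condition says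
  something at every vertex.\<close>

lemma two_facets_at_vertex:
  assumes F: "F facet_of P" and v: "v extreme_point_of F"
  obtains G where "G facet_of P" "G \<noteq> F" "v extreme_point_of G"
proof -
  have vP: "v extreme_point_of P" and "v \<in> F"
    using v extreme_point_of_face [OF facet_of_imp_face_of [OF F]] by auto
  have "{v} \<noteq> P"
    using interior_nonempty by auto
  have inter: "{v} = \<Inter> {G. G facet_of P \<and> {v} \<subseteq> G}"
    by (rule face_of_polyhedron [OF polyhedron _ _ \<open>{v} \<noteq> P\<close>]) (simp_all add: face_of_singleton vP)
  have "\<exists>G. G facet_of P \<and> v \<in> G \<and> G \<noteq> F"
  proof (rule ccontr)
    assume "\<not> ?thesis"
    then have "{G. G facet_of P \<and> {v} \<subseteq> G} = {F}"
      using F \<open>v \<in> F\<close> by blast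
    from trans [OF inter arg_cong [OF this, of Inter]] have "F = {v}"
      by simp
    with aff_dim_facet [OF F] show False
      by simp
  qed
  then obtain G where G: "G facet_of P" "v \<in> G" "G \<noteq> F"
    by blast
  then have "v extreme_point_of G"
    using extreme_point_of_face [OF facet_of_imp_face_of [OF G(1)]] vP by simp
  with G that show thesis
    by blast
qed

text \<open>The points of contact lie on the rays from v through a and b and differ from v, so
  replacing a and b by them leaves the angle unchanged.\<close>

lemma angle_at_vertex:
  assumes F: "closed_segment v a facet_of P" and G: "closed_segment v b facet_of P" and "a \<noteq> b"
  defines "t \<equiv> dist v (contact (closed_segment v a))"
  shows "angle_at v a b = arccos ((t\<^sup>2 - R\<^sup>2) / (t\<^sup>2 + R\<^sup>2))"
proof -
  define p q where "p = contact (closed_segment v a)" and "q = contact (closed_segment v b)"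
  have ne: "closed_segment v a \<noteq> closed_segment v b"
    using \<open>a \<noteq> b\<close> by (auto simp: doubleton_eq_iff)
  have "p \<noteq> q"
    using contact_inj [OF F G] ne by (auto simp: p_def q_def)
  have "p \<noteq> v" "q \<noteq> v"
    using contact_not_in_other_facet [OF F G ne] contact_not_in_other_facet [OF G F ne [symmetric]]
    by (auto simp: p_def q_def)
  obtain s where s: "0 \<le> s" "p = (1 - s) *\<^sub>R v + s *\<^sub>R a"
    using contact_in [OF F] by (auto simp: in_segment p_def)
  obtain r where r: "0 \<le> r" "q = (1 - r) *\<^sub>R v + r *\<^sub>R b"
    using contact_in [OF G] by (auto simp: in_segment q_def)
  have pv: "p - v = s *\<^sub>R (a - v)" and qv: "q - v = r *\<^sub>R (b - v)"
    using s r by (auto simp: algebra_simps)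
  have "s > 0" "r > 0"
    using pv qv s(1) r(1) \<open>p \<noteq> v\<close> \<open>q \<noteq> v\<close> by (auto simp: less_le)
  \<comment> \<open>All points are shifted by c, since the formula for tangents refers to a circle
    about 0.\<close>
  have "((p - c - (v - c)) \<bullet> (q - c - (v - c))) / (norm (p - c - (v - c)) * norm (q - c - (v - c)))
      = ((norm (p - c - (v - c)))\<^sup>2 - R\<^sup>2) / ((norm (p - c - (v - c)))\<^sup>2 + R\<^sup>2)"
  proof (rule cos_angle_between_tangents)
    show "norm (p - c) = R" "norm (q - c) = R"
      using norm_contact F G by (auto simp: p_def q_def)
    show "(p - c) \<bullet> (v - c) = R\<^sup>2" "(q - c) \<bullet> (v - c) = R\<^sup>2"
      unfolding p_def q_def by (rule inner_facet; use F G in simp)+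
  qed (use \<open>p \<noteq> q\<close> \<open>p \<noteq> v\<close> in auto)
  then have "((p - v) \<bullet> (q - v)) / (norm (p - v) * norm (q - v)) = (t\<^sup>2 - R\<^sup>2) / (t\<^sup>2 + R\<^sup>2)"
    by (simp add: t_def p_def dist_norm norm_minus_commute)
  moreover have "((p - v) \<bullet> (q - v)) / (norm (p - v) * norm (q - v))
      = ((a - v) \<bullet> (b - v)) / (norm (a - v) * norm (b - v))"
    unfolding pv qv using \<open>s > 0\<close> \<open>r > 0\<close> by simp
  ultimately show ?thesis
    by (simp add: angle_at_def)
qed

lemma dist_vertex_contact:
  assumes F: "F facet_of P"
  shows "dist (side_point F (lo F)) (contact F) = - lo F"
    and "dist (side_point F (hi F)) (contact F) = hi F"
proof -
  have "contact F = side_point F 0"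
    by (simp add: side_point_def)
  then show "dist (side_point F (lo F)) (contact F) = - lo F"
    and "dist (side_point F (hi F)) (contact F) = hi F"
    using side_points_in_facet(2,3) [OF F] by (simp_all add: dist_side_point)
qed

text \<open>The cosine of the angle at a vertex is 1 - 2 R^2 / (t^2 + R^2), injective in the tangent
  length t \<ge> 0. Equal angles therefore give equal tangent lengths at all vertices, in particular
  at both ends of each side.\<close>

lemma equiangular_imp_equal_tangent_lengths:
  assumes "equiangular_polygon P"
  obtains t where "t \<ge> 0" "\<And>F. F facet_of P \<Longrightarrow> hi F = t \<and> lo F = - t"
proof -
  obtain \<theta> where \<theta>: "\<forall>v a b. closed_segment v a facet_of P \<and> closed_segment v b facet_of P \<and> a \<noteq> b
      \<longrightarrow> angle_at v a b = \<theta>"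
    using assms unfolding equiangular_polygon_def by (rule exE)
  define g where "g t = (t\<^sup>2 - R\<^sup>2) / (t\<^sup>2 + R\<^sup>2)" for t
  have pos: "t\<^sup>2 + R\<^sup>2 > 0" for t
    using R_pos by (simp add: add_nonneg_pos)
  have "\<bar>g t\<bar> \<le> 1" for t
    using pos [of t] by (auto simp: g_def abs_le_iff field_simps)
  moreover have "t = u" if "g t = g u" "t \<ge> 0" "u \<ge> 0" for t u
  proof -
    have "(t\<^sup>2 - R\<^sup>2) * (u\<^sup>2 + R\<^sup>2) = (u\<^sup>2 - R\<^sup>2) * (t\<^sup>2 + R\<^sup>2)"
      using that(1) frac_eq_eq [OF pos [of t, THEN less_imp_neq, symmetric] pos [of u, THEN less_imp_neq, symmetric]]
      unfolding g_def by blast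
    then have "2 * R\<^sup>2 * t\<^sup>2 = 2 * R\<^sup>2 * u\<^sup>2"
      by algebra
    then show ?thesis
      using R_pos that by (simp add: power2_eq_iff_nonneg)
  qed
  ultimately have inj: "t = u" if "arccos (g t) = \<theta>" "arccos (g u) = \<theta>" "t \<ge> 0" "u \<ge> 0" for t u
    using that arccos_eq_iff by metis
  have vertex: "arccos (g (dist v (contact F))) = \<theta>" if F: "F facet_of P" and v: "v extreme_point_of F" for F v
  proof -
    obtain a where a: "F = closed_segment v a"
      using facet_eq_segment_from_vertex [OF F v] .
    obtain G where G: "G facet_of P" "G \<noteq> F" "v extreme_point_of G"
      using two_facets_at_vertex [OF F v] .
    obtain b where b: "G = closed_segment v b"
      using facet_eq_segment_from_vertex [OF G(1,3)] .
    have "a \<noteq> b"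
      using G(2) a b by blast
    have va: "closed_segment v a facet_of P" and vb: "closed_segment v b facet_of P"
      using F G(1) unfolding a b .
    show ?thesis
      unfolding g_def a angle_at_vertex [OF va vb \<open>a \<noteq> b\<close>, symmetric]
      using \<theta> va vb \<open>a \<noteq> b\<close> by blast
  qed
  have ends: "arccos (g (hi F)) = \<theta>" "arccos (g (- lo F)) = \<theta>" if F: "F facet_of P" for F
  proof -
    have "side_point F (hi F) extreme_point_of F" "side_point F (lo F) extreme_point_of F"
      by (simp_all add: extreme_point_of_facet [OF F])
    then show "arccos (g (hi F)) = \<theta>" "arccos (g (- lo F)) = \<theta>"
      using vertex [OF F, of "side_point F (hi F)"] vertex [OF F, of "side_point F (lo F)"]
      by (simp_all add: dist_vertex_contact [OF F])
  qed
  obtain F0 where F0: "F0 facet_of P"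
    using ray_meets_facet [OF dir_nonzero [of 0]] by blast
  show thesis
  proof (rule that [of "hi F0"])
    show "hi F0 \<ge> 0"
      using side_points_in_facet [OF F0] by simp
    fix F
    assume F: "F facet_of P"
    have "hi F = hi F0" "- lo F = hi F0"
      by (rule inj [OF ends(1) [OF F] ends(1) [OF F0]] inj [OF ends(2) [OF F] ends(1) [OF F0]];
          use side_points_in_facet(2,3) [OF F] side_points_in_facet(2,3) [OF F0] in simp)+
    then show "hi F = hi F0 \<and> lo F = - hi F0"
      by simp
  qed
qed

text \<open>A common tangent length t turns the angle sum into 2 n arctan (t / R) = 2 pi, which
  fixes t. Applied to Q this evaluates \<open>Lstar\<close>; applied to P it translates regularity
  into \<open>L = Lstar\<close>.\<close>

lemma regular_iff_perimeter: "regular_polygon P \<longleftrightarrow> perimeter P = 2 * R * (n * tan (pi / n))"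
proof
  assume "regular_polygon P"
  then obtain t where t: "t \<ge> 0" "\<And>F. F facet_of P \<Longrightarrow> hi F = t \<and> lo F = - t"
    using equiangular_imp_equal_tangent_lengths unfolding regular_polygon_def by blast
  have "2 * pi = (\<Sum>F | F facet_of P. arctan (t / R) - arctan (- t / R))"
    unfolding sum_arctan [symmetric] by (rule sum.cong) (auto simp: t(2))
  also have "\<dots> = n * (2 * arctan (t / R))"
    by (simp add: card_facets arctan_minus)
  finally have "arctan (t / R) = pi / n"
    using n_ge_3 by (simp add: field_simps)
  then have "t / R = tan (pi / n)"
    using tan_arctan [of "t / R"] by simp
  then have "t = R * tan (pi / n)"
    using R_pos by (simp add: field_simps)
  then show "perimeter P = 2 * R * (n * tan (pi / n))"
    unfolding perimeter_eq_iff using t(2) by auto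
next
  assume "perimeter P = 2 * R * (n * tan (pi / n))"
  then have eq: "hi F = R * tan (pi / n)" "lo F = - (R * tan (pi / n))" if "F facet_of P" for F
    using that unfolding perimeter_eq_iff by auto
  have "equilateral_polygon P"
    unfolding equilateral_polygon_def using diameter_facet eq by metis
  moreover have "equiangular_polygon P"
    unfolding equiangular_polygon_def
  proof (intro exI allI impI, elim conjE)
    fix v a b
    assume F: "closed_segment v a facet_of P" and G: "closed_segment v b facet_of P" and "a \<noteq> b"
    have "v extreme_point_of closed_segment v a"
      by (simp add: extreme_point_of_segment)
    then have "dist v (contact (closed_segment v a)) = R * tan (pi / n)"
      unfolding extreme_point_of_facet [OF F] using dist_vertex_contact [OF F] eq [OF F] by auto
    then show "angle_at v a b
        = arccos (((R * tan (pi / n))\<^sup>2 - R\<^sup>2) / ((R * tan (pi / n))\<^sup>2 + R\<^sup>2))"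
      using angle_at_vertex [OF F G \<open>a \<noteq> b\<close>] by simp
  qed
  ultimately show "regular_polygon P"
    by (simp add: regular_polygon_def)
qed

end

section \<open>The algebraic inequality and the conclusion\<close>

text \<open>The strict inequality k < y keeps one factor of the difference positive, so equality is
  decided by the other; m > 0 then allows roots to be taken.\<close>

lemma power_gap:
  fixes x y k :: real
  assumes "0 < k" "k < y" "y \<le> x" "m > 0"
  shows "k ^ m * (x ^ m - y ^ m) \<le> x ^ (2 * m) - y ^ m * x ^ m"
    and "x ^ (2 * m) - y ^ m * x ^ m = k ^ m * (x ^ m - y ^ m) \<longleftrightarrow> x = y"
proof -
  have diff: "x ^ (2 * m) - y ^ m * x ^ m - k ^ m * (x ^ m - y ^ m) = (x ^ m - y ^ m) * (x ^ m - k ^ m)"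
    unfolding mult_2 power_add by (simp add: algebra_simps)
  have "x ^ m - y ^ m \<ge> 0" "x ^ m - k ^ m > 0"
    using assms power_mono [of y x m] power_strict_mono [of k x m] by auto
  then show "k ^ m * (x ^ m - y ^ m) \<le> x ^ (2 * m) - y ^ m * x ^ m"
    using diff mult_nonneg_nonneg [of "x ^ m - y ^ m" "x ^ m - k ^ m"] by linarith
  have "x ^ (2 * m) - y ^ m * x ^ m = k ^ m * (x ^ m - y ^ m) \<longleftrightarrow> (x ^ m - y ^ m) * (x ^ m - k ^ m) = 0"
    using diff by linarith
  also have "\<dots> \<longleftrightarrow> x ^ m = y ^ m"
    using \<open>x ^ m - k ^ m > 0\<close> by simp
  also have "\<dots> \<longleftrightarrow> x = y"
    using assms by (intro power_eq_iff_eq_base) auto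
  finally show "x ^ (2 * m) - y ^ m * x ^ m = k ^ m * (x ^ m - y ^ m) \<longleftrightarrow> x = y" .
qed

theorem theorem3:
  fixes P Q :: "(real^2) set" and c :: "real^2" and R L A Lstar d :: real and n \<alpha> :: nat
  assumes "R > 0"
    and "convex_polygon n P" and "circumscribed_about P c R"
    and "convex_polygon n Q" and "circumscribed_about Q c R" and "regular_polygon Q"
    and "L = perimeter P" and "A = area P" and "Lstar = perimeter Q"
    and "d = real n * tan (pi / real n)"
    and "\<alpha> > 0"
  shows "(L ^ (2 * \<alpha>) - 4 ^ \<alpha> * (d * A) ^ \<alpha>
            \<ge> 2 ^ \<alpha> * R ^ \<alpha> * tan (pi / real n) ^ \<alpha> * (L ^ \<alpha> - Lstar ^ \<alpha>)) \<and>
         (L ^ (2 * \<alpha>) - 4 ^ \<alpha> * (d * A) ^ \<alpha>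
            = 2 ^ \<alpha> * R ^ \<alpha> * tan (pi / real n) ^ \<alpha> * (L ^ \<alpha> - Lstar ^ \<alpha>)
          \<longleftrightarrow> regular_polygon P) \<and>
         ((A / R\<^sup>2) ^ (2 * \<alpha>) - d ^ \<alpha> * (L / (2 * R)) ^ \<alpha>
            \<ge> tan (pi / real n) ^ \<alpha> * ((L / (2 * R)) ^ \<alpha> - (Lstar / (2 * R)) ^ \<alpha>)) \<and>
         ((A / R\<^sup>2) ^ (2 * \<alpha>) - d ^ \<alpha> * (L / (2 * R)) ^ \<alpha>
            = tan (pi / real n) ^ \<alpha> * ((L / (2 * R)) ^ \<alpha> - (Lstar / (2 * R)) ^ \<alpha>)
          \<longleftrightarrow> regular_polygon P)"
proof -
  interpret P: circumscribed_polygon P c R n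
    using assms by unfold_locales
  interpret Q: circumscribed_polygon Q c R n
    using assms by unfold_locales
  define \<tau> where "\<tau> = tan (pi / n)"
  have n: "n \<ge> 3"
    by (rule P.n_ge_3)
  then have "\<tau> > 0"
    unfolding \<tau>_def by (intro tan_gt_zero) (auto simp: field_simps)
  have "\<tau> < d"
    using assms(10) n \<open>\<tau> > 0\<close> by (auto simp: \<tau>_def)
  have Lstar: "Lstar = 2 * R * d"
    using Q.regular_iff_perimeter \<open>regular_polygon Q\<close> \<open>Lstar = _\<close> \<open>d = real n * tan _\<close> by simp
  have regular: "regular_polygon P \<longleftrightarrow> L = Lstar"
    using P.regular_iff_perimeter Lstar assms(7,10) by simp
  have "Lstar \<le> L"
    using P.perimeter_ge Lstar assms(7,10) by simp
  have A: "A = R * L / 2"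
    using P.area_eq assms(7,8) by simp
  \<comment> \<open>This identity brings the left-hand side to the form
    \<open>x ^ (2 * m) - y ^ m * x ^ m\<close>.\<close>
  have "4 * (d * A) = Lstar * L"
    unfolding A Lstar by simp
  then have first: "4 ^ \<alpha> * (d * A) ^ \<alpha> = Lstar ^ \<alpha> * L ^ \<alpha>"
    by (metis power_mult_distrib)
  have factor: "2 ^ \<alpha> * R ^ \<alpha> * \<tau> ^ \<alpha> = (2 * R * \<tau>) ^ \<alpha>"
    by (simp only: power_mult_distrib)
  have second: "A / R\<^sup>2 = L / (2 * R)"
    unfolding A using \<open>R > 0\<close> by (simp add: power2_eq_square)
  have third: "Lstar / (2 * R) = d"
    unfolding Lstar using \<open>R > 0\<close> by simp
  have "0 < 2 * R * \<tau>" "2 * R * \<tau> < Lstar"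
    unfolding Lstar using \<open>R > 0\<close> \<open>\<tau> > 0\<close> \<open>\<tau> < d\<close> by simp_all
  note gap1 = power_gap [OF this \<open>Lstar \<le> L\<close> \<open>\<alpha> > 0\<close>]
  have "Lstar / (2 * R) \<le> L / (2 * R)"
    using \<open>R > 0\<close> \<open>Lstar \<le> L\<close> by (intro divide_right_mono) simp_all
  then have "d \<le> L / (2 * R)"
    unfolding third .
  \<comment> \<open>The same inequality for the numbers divided by \<open>2 * R\<close>: \<tau>, d
    and \<open>L / (2 * R)\<close>.\<close>
  note gap2 = power_gap [OF \<open>\<tau> > 0\<close> \<open>\<tau> < d\<close> this \<open>\<alpha> > 0\<close>]
  have "L / (2 * R) = d \<longleftrightarrow> L = Lstar"
    unfolding third [symmetric] using \<open>R > 0\<close> by simp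
  then show ?thesis
    unfolding \<tau>_def [symmetric] first factor second third regular
    using gap1 gap2 by blast
qed

end
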